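(* For every integer $n \geq 3$ and every $\beta \in \mathbb{Z}$, there exists a smallest real number $\alpha_{\min}$ (depending on $n$ and $\beta$) such that $\Psi_{\alpha,\beta}[-]$ preserves $\mathbb{P}_n(\mathbb{C})$ for all $\alpha \geq \alpha_{\min}$. Moreover, $\alpha_{\min} = \max(1,|\beta|)$ for $n=3$, while for $n \geq 4$, $$\max\left(n-2, |\beta| + 2\lfloor (\sqrt{8n+1}-5)/2 \rfloor\right) \leq \alpha_{\min} \leq |\beta| + 2n - 6.$$
   Context: $\mathbb{P}_n(\mathbb{C})$ denotes the set of $n \times n$ complex Hermitian positive semidefinite matrices. For $\alpha \in \mathbb{R}$, $\beta \in \mathbb{Z}$, $\Psi_{\alpha,\beta}:\mathbb{C}\to\mathbb{C}$ is defined by $\Psi_{\alpha,\beta}(re^{i\theta}) := r^\alpha e^{i\beta\theta}$ for $r>0$, $\theta \in (-\pi,\pi]$, and $\Psi_{\alpha,\beta}(0) := 0$. For a matrix $A = (a_{st})$, $\Psi_{\alpha,\beta}[A] := (\Psi_{\alpha,\beta}(a_{st}))$. "$\Psi_{\alpha,\beta}[-]$ preserves $\mathbb{P}_n(\mathbb{C})$" means $\Psi_{\alpha,\beta}[A] \in \mathbb{P}_n(\mathbb{C})$ for all $A \in \mathbb{P}_n(\mathbb{C})$. *)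

theory Defs
  imports Complex_Main "Jordan_Normal_Form.Schur_Decomposition"
begin

definition Psi :: "real \<Rightarrow> int \<Rightarrow> complex \<Rightarrow> complex" where
  "Psi \<alpha> \<beta> z = (if z = 0 then 0 else rcis (cmod z powr \<alpha>) (of_int \<beta> * Arg z))"

lemma Psi_rcis:
  assumes "r > 0" "-pi < \<theta>" "\<theta> \<le> pi"
  shows "Psi \<alpha> \<beta> (rcis r \<theta>) = complex_of_real (r powr \<alpha>) * exp (\<i> * of_int \<beta> * of_real \<theta>)"
proof -
  have "sgn (rcis r \<theta>) = cis \<theta>"
    using assms(1) by (simp add: rcis_def sgn_div_norm norm_mult scaleR_conv_of_real)
  then have "Arg (rcis r \<theta>) = \<theta>"
    using assms by (intro cis_Arg_unique) auto
  then show ?thesis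
    using assms(1) by (simp add: Psi_def rcis_def cis_conv_exp mult.assoc norm_mult)
qed

text \<open>The inequality is in the componentwise partial order on the complex numbers, and
  \<open>(A *\<^sub>v v) \<bullet>c v\<close> is the number usually written \<open>v\<^sup>* A v\<close>.\<close>

definition PSD :: "nat \<Rightarrow> complex mat set" where
  "PSD n = {A \<in> carrier_mat n n. mat_adjoint A = A \<and>
              (\<forall>v \<in> carrier_vec n. 0 \<le> (A *\<^sub>v v) \<bullet>c v)}"

definition preserves_PSD :: "nat \<Rightarrow> (complex \<Rightarrow> complex) \<Rightarrow> bool" where
  "preserves_PSD n f \<longleftrightarrow> (\<forall>A \<in> PSD n. map_mat f A \<in> PSD n)"

end

theory Submission
  imports Defs "HOL-Analysis.Generalised_Binomial_Theorem"
begin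

text \<open>
  Write \<open>p = (\<alpha> + \<beta>) / 2\<close> and \<open>q = (\<alpha> - \<beta>) / 2\<close>. Away from zero, \<open>Psi \<alpha> \<beta> z\<close> is formally
  \<open>z\<^sup>p \<cdot> cnj z\<^sup>q\<close>, and both bounds for the threshold come from this form.

  Upper bound. As in the method of FitzGerald and Horn, a Schur complement step writes a positive
  semidefinite matrix \<open>A\<close> of size \<open>n + 1\<close> as \<open>\<zeta>\<zeta>\<^sup>* + B\<close>, where the last row and column of \<open>B\<close> vanish and
  \<open>B\<close> is positive semidefinite (\<open>psd_split_rank_one\<close>). Along the segment \<open>\<zeta>\<zeta>\<^sup>* + t B\<close> the
  derivative of the entrywise image is the sum of \<open>p\<close> times the Schur product of \<open>B\<close> with the image
  under \<open>Psi (\<alpha> - 1) (\<beta> - 1)\<close> and \<open>q\<close> times the Schur product of \<open>cnj B\<close> with the image under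
  \<open>Psi (\<alpha> - 1) (\<beta> + 1)\<close>. Only the leading block of size \<open>n\<close> matters, because the last row and column of \<open>B\<close>
  vanish. Hence if both derived maps preserve positivity in size \<open>n\<close>, \<open>\<alpha> > 1\<close> and \<open>\<bar>\<beta>\<bar> \<le> \<alpha>\<close>, then the image
  increases along the segment, and it starts at a matrix of rank at most one, since \<open>Psi\<close> is
  multiplicative (\<open>preserves_PSD_Suc\<close>). In size two every
  \<open>\<alpha> > 0\<close> works, so induction gives all \<open>\<alpha> > max 1 (\<bar>\<beta>\<bar> + 2 n - 6)\<close> (\<open>preserves_PSD_above\<close>).

  Lower bound. Apply \<open>Psi \<alpha> \<beta>\<close> to the matrix with entries \<open>1 + \<epsilon> z\<^sub>i cnj z\<^sub>j\<close> and expand in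
  powers of \<open>\<epsilon>\<close> by the binomial series. If a vector \<open>v\<close> annihilates all monomials
  \<open>z\<^sup>a cnj z\<^sup>b\<close> of degree below \<open>M\<close>, the quadratic form at \<open>cnj v\<close> has the leading coefficient
  \<open>\<Sum>a\<le>M. (p gchoose a) (q gchoose (M - a)) \<bar>\<mu> a (M - a)\<bar>\<^sup>2\<close>, where \<open>\<mu>\<close> denotes the moments of \<open>v\<close>.
  It must be nonnegative (\<open>leading_coefficient_nonneg\<close>). Two choices of points are used. For
  real points and \<open>M = n - 1\<close> it is a positive multiple of \<open>\<alpha> gchoose (n - 1)\<close>, which is negative for
  \<open>n - 3 < \<alpha> < n - 2\<close>. For roots of unity of order \<open>2 M + 1\<close> the vector \<open>v\<close> can be chosen to
  single out \<open>cnj z\<^sup>M\<close>, and \<open>q gchoose M\<close> remains; it is negative just below \<open>\<alpha> = \<beta> + 2 (M - 1)\<close>, and conjugation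
  makes it possible to replace \<open>\<beta>\<close> by \<open>\<bar>\<beta>\<bar>\<close>. This takes only \<open>2 M + 1\<close> points
  instead of one for each of the \<open>(M + 1) (M + 2) / 2\<close> monomials of degree at most \<open>M\<close>, the count from which the square root in the theorem arises.

  The threshold is the infimum of all \<open>a\<close> such that every \<open>\<alpha> \<ge> a\<close> preserves positivity; it is
  attained because positivity of the image passes to the limit in \<open>\<alpha>\<close>.
\<close>

section \<open>Positive semidefinite forms\<close>

text \<open>Matrices are handled as functions on index pairs, so that all sizes share one type and
  induction on the size needs no conversions.\<close>

definition qform :: "nat \<Rightarrow> (nat \<Rightarrow> nat \<Rightarrow> complex) \<Rightarrow> (nat \<Rightarrow> complex) \<Rightarrow> complex" where
  "qform n A v = (\<Sum>i<n. \<Sum>j<n. cnj (v i) * A i j * v j)"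

definition psd :: "nat \<Rightarrow> (nat \<Rightarrow> nat \<Rightarrow> complex) \<Rightarrow> bool" where
  "psd n A \<longleftrightarrow> (\<forall>i<n. \<forall>j<n. A j i = cnj (A i j)) \<and> (\<forall>v. 0 \<le> Re (qform n A v))"

lemma psdI:
  assumes "\<And>i j. i < n \<Longrightarrow> j < n \<Longrightarrow> A j i = cnj (A i j)" "\<And>v. 0 \<le> Re (qform n A v)"
  shows "psd n A"
  using assms unfolding psd_def by blast

lemma psd_herm: "psd n A \<Longrightarrow> i < n \<Longrightarrow> j < n \<Longrightarrow> A j i = cnj (A i j)"
  unfolding psd_def by blast

lemma psd_nonneg: "psd n A \<Longrightarrow> 0 \<le> Re (qform n A v)"
  unfolding psd_def by blast

lemma qform_cong:
  "(\<And>i j. i < n \<Longrightarrow> j < n \<Longrightarrow> A i j = B i j) \<Longrightarrow> (\<And>i. i < n \<Longrightarrow> v i = w i) \<Longrightarrow> qform n A v = qform n B w"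
  unfolding qform_def by (intro sum.cong) auto

lemma psd_cong:
  assumes "\<And>i j. i < n \<Longrightarrow> j < n \<Longrightarrow> A i j = B i j" "psd n A"
  shows "psd n B"
proof (rule psdI)
  fix i j assume "i < n" "j < n"
  then show "B j i = cnj (B i j)" using assms(1)[of i j] assms(1)[of j i] psd_herm[OF assms(2), of i j] by simp
next
  fix v show "0 \<le> Re (qform n B v)"
    using psd_nonneg[OF assms(2), of v] qform_cong[of n A B v v] assms(1) by simp
qed

lemma qform_hermitian_real:
  assumes "\<And>i j. i < n \<Longrightarrow> j < n \<Longrightarrow> A j i = cnj (A i j)"
  shows "Im (qform n A v) = 0"
proof -
  have "cnj (qform n A v) = (\<Sum>i<n. \<Sum>j<n. v i * A j i * cnj (v j))"
    unfolding qform_def cnj_sum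
  proof (intro sum.cong refl)
    fix i j assume "i \<in> {..<n}" "j \<in> {..<n}"
    then have "A j i = cnj (A i j)" by (intro assms) auto
    then show "cnj (cnj (v i) * A i j * v j) = v i * A j i * cnj (v j)" by simp
  qed
  also have "\<dots> = qform n A v"
    unfolding qform_def by (subst sum.swap) (simp add: mult_ac)
  finally have "cnj (qform n A v) = qform n A v" .
  then show ?thesis by (simp add: complex_eq_iff)
qed

lemma PSD_mat_iff: "Matrix.mat n n (\<lambda>(i, j). A i j) \<in> PSD n \<longleftrightarrow> psd n A"
proof -
  let ?M = "Matrix.mat n n (\<lambda>(i, j). A i j)"
  have herm: "mat_adjoint ?M = ?M \<longleftrightarrow> (\<forall>i<n. \<forall>j<n. A j i = cnj (A i j))"
  proof -
    have dim: "dim_row (mat_adjoint ?M) = n" "dim_col (mat_adjoint ?M) = n"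
      by (simp_all add: mat_adjoint_def)
    have "mat_adjoint ?M $$ (i, j) = cnj (A j i)" if "i < n" "j < n" for i j
      using that by (simp add: mat_adjoint_def mat_of_rows_index)
    then have "mat_adjoint ?M = ?M \<longleftrightarrow> (\<forall>i<n. \<forall>j<n. cnj (A j i) = A i j)"
      by (simp add: mat_eq_iff dim)
    then show ?thesis by metis
  qed
  have qf: "(?M *\<^sub>v v) \<bullet>c v = qform n A (\<lambda>i. vec_index v i)" if "v \<in> carrier_vec n" for v
    using that unfolding qform_def
    by (auto simp: scalar_prod_def sum_distrib_left sum_distrib_right mult_ac atLeast0LessThan
          intro!: sum.cong)
  have qv: "qform n A w = (?M *\<^sub>v Matrix.vec n w) \<bullet>c Matrix.vec n w" for w
    by (subst qf) (auto intro!: qform_cong)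
  show ?thesis
  proof
    assume "?M \<in> PSD n"
    then show "psd n A"
      unfolding PSD_def mem_Collect_eq herm
      by (intro psdI) (blast, simp add: qv less_eq_complex_def)
  next
    assume A: "psd n A"
    then have h: "\<forall>i<n. \<forall>j<n. A j i = cnj (A i j)" unfolding psd_def by blast
    have "0 \<le> (?M *\<^sub>v v) \<bullet>c v" if "v \<in> carrier_vec n" for v
    proof -
      have "Im (qform n A (vec_index v)) = 0"
        by (rule qform_hermitian_real) (use h in blast)
      then show ?thesis
        by (simp add: qf[OF that] less_eq_complex_def psd_nonneg[OF A])
    qed
    then show "?M \<in> PSD n"
      unfolding PSD_def mem_Collect_eq herm by (intro conjI h ballI) simp_all
  qed
qed

lemma preserves_PSD_iff:
  "preserves_PSD n f \<longleftrightarrow> (\<forall>A. psd n A \<longrightarrow> psd n (\<lambda>i j. f (A i j)))"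
proof -
  have ex: "\<exists>A. M = Matrix.mat n n (\<lambda>(i, j). A i j)" if "M \<in> PSD n" for M
    using that by (intro exI[of _ "\<lambda>i j. M $$ (i, j)"] eq_matI) (auto simp: PSD_def)
  have "map_mat f (Matrix.mat n n (\<lambda>(i, j). A i j)) = Matrix.mat n n (\<lambda>(i, j). f (A i j))" for A
    by (auto simp: mat_eq_iff)
  then show ?thesis
    unfolding preserves_PSD_def by (metis PSD_mat_iff ex)
qed

lemma psd_cnj:
  assumes "psd n A" shows "psd n (\<lambda>i j. cnj (A i j))"
proof (rule psdI)
  fix v
  have "qform n (\<lambda>i j. cnj (A i j)) v = cnj (qform n A (\<lambda>i. cnj (v i)))"
    unfolding qform_def by simp
  then show "0 \<le> Re (qform n (\<lambda>i j. cnj (A i j)) v)"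
    using psd_nonneg[OF assms] by simp
next
  fix i j assume "i < n" "j < n"
  then show "cnj (A j i) = cnj (cnj (A i j))" by (simp add: psd_herm[OF assms, of i j])
qed

lemma psd_add:
  assumes "psd n A" "psd n B" shows "psd n (\<lambda>i j. A i j + B i j)"
proof (rule psdI)
  fix v
  have "qform n (\<lambda>i j. A i j + B i j) v = qform n A v + qform n B v"
    unfolding qform_def by (simp add: sum.distrib distrib_left distrib_right)
  then show "0 \<le> Re (qform n (\<lambda>i j. A i j + B i j) v)"
    using psd_nonneg[OF assms(1)] psd_nonneg[OF assms(2)] by simp
next
  fix i j assume "i < n" "j < n"
  then show "A j i + B j i = cnj (A i j + B i j)"
    by (simp add: psd_herm[OF assms(1), of i j] psd_herm[OF assms(2), of i j])
qed

lemma psd_scale: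
  assumes "psd n A" "0 \<le> (c::real)" shows "psd n (\<lambda>i j. of_real c * A i j)"
proof (rule psdI)
  fix v
  have "qform n (\<lambda>i j. of_real c * A i j) v = of_real c * qform n A v"
    unfolding qform_def by (simp add: sum_distrib_left mult_ac)
  then show "0 \<le> Re (qform n (\<lambda>i j. of_real c * A i j) v)"
    using psd_nonneg[OF assms(1)] assms(2) by simp
next
  fix i j assume "i < n" "j < n"
  then show "of_real c * A j i = cnj (of_real c * A i j)" by (simp add: psd_herm[OF assms(1), of i j])
qed

lemma qform_rank_one:
  "qform n (\<lambda>i j. \<zeta> i * cnj (\<zeta> j)) v = of_real ((cmod (\<Sum>i<n. cnj (v i) * \<zeta> i))\<^sup>2)"
proof -
  have "qform n (\<lambda>i j. \<zeta> i * cnj (\<zeta> j)) v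
      = (\<Sum>i<n. cnj (v i) * \<zeta> i) * cnj (\<Sum>i<n. cnj (v i) * \<zeta> i)"
    unfolding qform_def cnj_sum sum_product by (simp add: mult_ac)
  then show ?thesis by (metis complex_norm_square)
qed

lemma psd_rank_one: "psd n (\<lambda>i j. \<zeta> i * cnj (\<zeta> j))"
  by (rule psdI) (simp_all add: qform_rank_one)

lemma psd_diag:
  assumes "psd n A" "i < n"
  shows "A i i = of_real (Re (A i i))" "0 \<le> Re (A i i)"
proof -
  show "A i i = of_real (Re (A i i))"
    using psd_herm[OF assms(1) assms(2) assms(2)] by (metis Reals_cnj_iff of_real_Re)
  have "qform n A (\<lambda>k. if k = i then 1 else 0)
      = (\<Sum>k<n. \<Sum>j<n. if k = i \<and> j = i then A i i else 0)"
    unfolding qform_def by (intro sum.cong) auto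
  also have "\<dots> = (\<Sum>k<n. if k = i then A i i else 0)"
    using assms(2) by (intro sum.cong) auto
  also have "\<dots> = A i i" using assms(2) by simp
  finally show "0 \<le> Re (A i i)" using psd_nonneg[OF assms(1)] by metis
qed

text \<open>Bordering a Hermitian form by one row and column: the shape in which the square can be
  completed in the last variable.\<close>

lemma qform_Suc:
  assumes "psd (Suc n) A"
  shows "qform (Suc n) A v = qform n A v + cnj (v n) * (\<Sum>j<n. A n j * v j)
     + v n * cnj (\<Sum>j<n. A n j * v j) + A n n * of_real ((cmod (v n))\<^sup>2)"
proof -
  have "cnj (A n i) = A i n" if "i < n" for i using psd_herm[OF assms, of n i] that by simp
  then have "cnj (\<Sum>j<n. A n j * v j) = (\<Sum>i<n. cnj (v i) * A i n)"
    by (simp add: cnj_sum mult_ac)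
  then show ?thesis
    unfolding qform_def complex_norm_square
    by (simp add: sum.distrib sum_distrib_left sum_distrib_right algebra_simps)
qed

text \<open>With \<open>A n n = 0\<close> the form is affine in the last variable, so a nonzero off-diagonal
  entry would let it become negative.\<close>

lemma psd_zero_diag:
  assumes A: "psd (Suc n) A" and 0: "A n n = 0" and i: "i < n"
  shows "A i n = 0"
proof (rule ccontr)
  assume ne: "A i n \<noteq> 0"
  have h: "A j i = cnj (A i j)" if "i \<le> n" "j \<le> n" for i j by (rule psd_herm[OF A]) (use that in auto)
  note q_Suc = qform_Suc[OF A]
  let ?a = "A n i"
  have aN: "?a \<noteq> 0" using ne h[of i n] i by simp
  \<comment> \<open>This \<open>t\<close> makes the value of the form at \<open>e\<^sub>i - t a e\<^sub>n\<close> equal to \<open>-1\<close>.\<close>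
  define t where "t = (Re (A i i) + 1) / (2 * (cmod ?a)\<^sup>2)"
  define v where "v = (\<lambda>k. if k = i then 1 else if k = n then - (of_real t * ?a) else 0 :: complex)"
  have s: "(\<Sum>j<n. A n j * v j) = ?a"
  proof -
    have "(\<Sum>j<n. A n j * v j) = (\<Sum>j<n. if j = i then ?a else 0)"
      by (intro sum.cong) (auto simp: v_def)
    then show ?thesis using i by simp
  qed
  have q: "qform n A v = A i i"
  proof -
    have "qform n A v = (\<Sum>k<n. \<Sum>j<n. if k = i \<and> j = i then A i i else 0)"
      unfolding qform_def by (intro sum.cong) (auto simp: v_def)
    also have "\<dots> = (\<Sum>k<n. if k = i then A i i else 0)"
      using i by (intro sum.cong) auto
    finally show ?thesis using i by simp
  qed
  have vn: "v n = - (of_real t * ?a)" using i by (simp add: v_def)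
  have "Re (qform (Suc n) A v) = Re (A i i) - 2 * t * (cmod ?a)\<^sup>2"
    unfolding q_Suc s q vn 0 cmod_power2
    by (simp add: algebra_simps power2_eq_square)
  also have "\<dots> = -1" using aN by (simp add: t_def field_simps)
  finally show False using psd_nonneg[OF A, of v] by simp
qed

text \<open>The Schur complement of the last diagonal entry. The block \<open>B\<close> is again positive
  semidefinite, since its form at \<open>v\<close> is the form of \<open>A\<close> minimised over the last coordinate. If the diagonal entry
  vanishes, then so do its row and column, and \<open>\<zeta> = 0\<close> works.\<close>

lemma psd_split_rank_one:
  assumes A: "psd (Suc n) A"
  obtains \<zeta> B where "psd n B"
    "\<And>i j. i \<le> n \<Longrightarrow> j \<le> n \<Longrightarrow> A i j = \<zeta> i * cnj (\<zeta> j) + (if i < n \<and> j < n then B i j else 0)"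
proof -
  have h: "A j i = cnj (A i j)" if "i \<le> n" "j \<le> n" for i j by (rule psd_herm[OF A]) (use that in auto)
  note q_Suc = qform_Suc[OF A]
  define a where "a = Re (A n n)"
  have a: "A n n = of_real a" "0 \<le> a" using psd_diag[OF A, of n] by (auto simp: a_def)
  \<comment> \<open>For \<open>a = 0\<close> the convention \<open>x / 0 = 0\<close> gives the required \<open>\<zeta> = 0\<close>; likewise for \<open>w\<close> below.\<close>
  define \<zeta> where "\<zeta> i = A i n / of_real (sqrt a)" for i
  define B where "B i j = A i j - \<zeta> i * cnj (\<zeta> j)" for i j
  have z0: "A i n = 0" if "a = 0" "i \<le> n" for i
    using psd_zero_diag[OF A, of i] a that by (cases "i = n") auto
  have zz: "\<zeta> i * cnj (\<zeta> j) = A i n * cnj (A j n) / of_real a" for i j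
    using a(2) by (simp add: \<zeta>_def flip: of_real_mult)
  have last: "A i n = \<zeta> i * cnj (\<zeta> n)" if "i \<le> n" for i
    using z0[OF _ that] a by (cases "a = 0") (auto simp: zz)
  have last': "A n i = \<zeta> n * cnj (\<zeta> i)" if "i \<le> n" for i
    using last[OF that] h[of i n] that by (simp add: mult.commute)
  have "psd n B"
  proof (rule psdI)
    fix v :: "nat \<Rightarrow> complex"
    define s where "s = (\<Sum>j<n. A n j * v j)"
    \<comment> \<open>The last coordinate that minimises the form when the others are \<open>v\<close>.\<close>
    define w where "w = v(n := - s / of_real a)"
    have sw: "(\<Sum>j<n. A n j * w j) = s" unfolding s_def by (intro sum.cong) (auto simp: w_def)
    have qw: "qform n A w = qform n A v" by (intro qform_cong) (auto simp: w_def)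
    have wn: "w n = - s / of_real a" by (simp add: w_def)
    have zs: "(\<Sum>i<n. cnj (v i) * \<zeta> i) = cnj s / of_real (sqrt a)"
    proof -
      have "cnj (v i) * \<zeta> i = cnj (A n i * v i) / of_real (sqrt a)" if "i < n" for i
        using h[of n i] that by (simp add: \<zeta>_def)
      then show ?thesis unfolding s_def cnj_sum sum_divide_distrib by (intro sum.cong) auto
    qed
    have "qform n B v = qform n A v - qform n (\<lambda>i j. \<zeta> i * cnj (\<zeta> j)) v"
      unfolding qform_def B_def by (simp add: sum_subtractf left_diff_distrib right_diff_distrib)
    also have "\<dots> = qform n A v - of_real ((cmod s)\<^sup>2 / a)"
      unfolding qform_rank_one zs using a(2) by (simp add: norm_divide power_divide)
    finally have B: "Re (qform n B v) = Re (qform n A v) - (cmod s)\<^sup>2 / a" by simp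
    have "qform (Suc n) A w = qform n A v - of_real ((cmod s)\<^sup>2 / a)"
      unfolding q_Suc sw qw wn a(1)
      by (cases "a = 0") (auto simp: complex_norm_square[unfolded of_real_power] norm_divide power_divide field_simps
            power2_eq_square[of "complex_of_real a"] power2_eq_square[of a])
    then show "0 \<le> Re (qform n B v)" using psd_nonneg[OF A, of w] B by simp
  next
    fix i j assume "i < n" "j < n"
    then show "B j i = cnj (B i j)" using h[of i j] by (simp add: B_def mult.commute)
  qed
  moreover have "A i j = \<zeta> i * cnj (\<zeta> j) + (if i < n \<and> j < n then B i j else 0)"
    if "i \<le> n" "j \<le> n" for i j
    using last[of i] last'[of j] that by (cases "i = n"; cases "j = n") (auto simp: B_def)
  ultimately show ?thesis using that by blast
qed

lemma psd_sum_rank_one: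
  assumes "psd n A"
  shows "\<exists>Z. \<forall>i<n. \<forall>j<n. A i j = (\<Sum>k<n. Z k i * cnj (Z k j))"
  using assms
proof (induction n arbitrary: A)
  case (Suc n)
  from psd_split_rank_one[OF Suc.prems] obtain \<zeta> B where B: "psd n B"
    and dec: "\<And>i j. i \<le> n \<Longrightarrow> j \<le> n \<Longrightarrow> A i j = \<zeta> i * cnj (\<zeta> j) + (if i < n \<and> j < n then B i j else 0)"
    by metis
  from Suc.IH[OF B] obtain Z where Z: "\<And>i j. i < n \<Longrightarrow> j < n \<Longrightarrow> B i j = (\<Sum>k<n. Z k i * cnj (Z k j))"
    by blast
  let ?Z = "\<lambda>k i. if k = n then \<zeta> i else if i < n then Z k i else 0"
  have "A i j = (\<Sum>k<Suc n. ?Z k i * cnj (?Z k j))" if "i < Suc n" "j < Suc n" for i j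
  proof -
    have "(\<Sum>k<n. ?Z k i * cnj (?Z k j)) = (\<Sum>k<n. if i < n \<and> j < n then Z k i * cnj (Z k j) else 0)"
      by (intro sum.cong refl) simp
    also have "\<dots> = (if i < n \<and> j < n then B i j else 0)" by (cases "i < n \<and> j < n") (auto simp: Z)
    finally show ?thesis using that dec[of i j] by simp
  qed
  then show ?case by (intro exI[of _ ?Z] allI impI)
qed simp

text \<open>Writing \<open>B\<close> as a sum of rank one forms turns the form of the entrywise product at \<open>v\<close> into
  a sum of values of the form of \<open>A\<close>.\<close>

lemma psd_Schur_product:
  assumes A: "psd n A" and B: "psd n B"
  shows "psd n (\<lambda>i j. A i j * B i j)"
proof (rule psdI)
  fix v
  from psd_sum_rank_one[OF B] obtain Z where
    Z: "\<And>i j. i < n \<Longrightarrow> j < n \<Longrightarrow> B i j = (\<Sum>k<n. Z k i * cnj (Z k j))" by blast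
  have "qform n (\<lambda>i j. A i j * B i j) v
      = (\<Sum>i<n. \<Sum>j<n. \<Sum>k<n. cnj (cnj (Z k i) * v i) * A i j * (cnj (Z k j) * v j))"
    unfolding qform_def by (intro sum.cong refl) (simp add: Z sum_distrib_left mult_ac sum_distrib_right)
  also have "\<dots> = (\<Sum>i<n. \<Sum>k<n. \<Sum>j<n. cnj (cnj (Z k i) * v i) * A i j * (cnj (Z k j) * v j))"
    by (rule sum.cong[OF refl], rule sum.swap)
  also have "\<dots> = (\<Sum>k<n. qform n A (\<lambda>i. cnj (Z k i) * v i))"
    unfolding qform_def by (rule sum.swap)
  finally show "0 \<le> Re (qform n (\<lambda>i j. A i j * B i j) v)"
    by (simp add: Re_sum sum_nonneg psd_nonneg[OF A])
next
  fix i j assume "i < n" "j < n"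
  then show "A j i * B j i = cnj (A i j * B i j)"
    by (simp add: psd_herm[OF A, of i j] psd_herm[OF B, of i j])
qed

section \<open>The power maps\<close>

lemma preserves_PSD_D: "preserves_PSD n f \<Longrightarrow> psd n A \<Longrightarrow> psd n (\<lambda>i j. f (A i j))"
  unfolding preserves_PSD_iff by (drule spec) (erule mp)

lemma Psi_0 [simp]: "Psi \<alpha> \<beta> 0 = 0"
  by (simp add: Psi_def)

text \<open>The powers with integer exponent make it visible that \<open>Psi\<close> is smooth across the negative
  real axis, where \<open>Arg\<close> jumps.\<close>

lemma Psi_eq_power_int:
  assumes "z \<noteq> 0"
  shows "Psi \<alpha> \<beta> z = of_real (cmod z powr (\<alpha> - of_int \<beta>)) * z powi \<beta>"
proof -
  have "z powi \<beta> = (of_real (cmod z) * cis (Arg z)) powi \<beta>"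
    using rcis_cmod_Arg[of z] by (simp add: rcis_def)
  also have "\<dots> = of_real (cmod z powr of_int \<beta>) * cis (of_int \<beta> * Arg z)"
    using assms by (simp add: power_int_mult_distrib cis_power_int powr_real_of_int')
  finally show ?thesis
    using assms by (simp add: Psi_def rcis_def powr_diff)
qed

lemma norm_Psi: "cmod (Psi \<alpha> \<beta> z) = cmod z powr \<alpha>"
  by (simp add: Psi_def)

lemma Psi_mult: "Psi \<alpha> \<beta> (z * w) = Psi \<alpha> \<beta> z * Psi \<alpha> \<beta> w"
  by (cases "z = 0 \<or> w = 0")
    (auto simp: Psi_eq_power_int norm_mult powr_mult power_int_mult_distrib)

lemma Psi_cnj: "Psi \<alpha> \<beta> (cnj z) = cnj (Psi \<alpha> \<beta> z)"
  by (cases "z = 0") (auto simp: Psi_eq_power_int)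

lemma Psi_uminus_exponent: "Psi \<alpha> (- \<beta>) z = cnj (Psi \<alpha> \<beta> z)"
  by (simp add: Psi_def rcis_def cis_cnj)

text \<open>Negating \<open>\<beta>\<close> conjugates the image, which keeps it positive semidefinite.\<close>

lemma preserves_PSD_uminus:
  assumes "preserves_PSD n (Psi \<alpha> \<beta>)" shows "preserves_PSD n (Psi \<alpha> (- \<beta>))"
  unfolding preserves_PSD_iff Psi_uminus_exponent
  by (intro allI impI psd_cnj preserves_PSD_D[OF assms])

lemma preserves_PSD_abs:
  "preserves_PSD n (Psi \<alpha> \<bar>\<beta>\<bar>) \<longleftrightarrow> preserves_PSD n (Psi \<alpha> \<beta>)"
  using preserves_PSD_uminus[of n \<alpha> \<beta>] preserves_PSD_uminus[of n \<alpha> "-\<beta>"]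
  by (auto simp: abs_if)

section \<open>Sufficient exponents\<close>

text \<open>The chain rule for \<open>z\<^sup>p cnj z\<^sup>q\<close> with \<open>p = (\<alpha> + \<beta>) / 2\<close> and \<open>q = (\<alpha> - \<beta>) / 2\<close>: the two
  summands are the Wirtinger derivatives in the direction \<open>b\<close>, and each lowers \<open>\<alpha>\<close> by one and
  shifts \<open>\<beta>\<close> by one.\<close>

lemma has_vector_derivative_Psi_nonzero:
  fixes z b :: complex and t \<alpha> :: real and \<beta> :: int
  defines "u \<equiv> z + of_real t * b"
  assumes u0: "u \<noteq> 0"
  shows "((\<lambda>s. Psi \<alpha> \<beta> (z + of_real s * b)) has_vector_derivative
           of_real ((\<alpha> + \<beta>) / 2) * (Psi (\<alpha> - 1) (\<beta> - 1) u * b)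
         + of_real ((\<alpha> - \<beta>) / 2) * (Psi (\<alpha> - 1) (\<beta> + 1) u * cnj b)) (at t)"
proof -
  define c where "c = \<alpha> - real_of_int \<beta>"
  let ?g = "\<lambda>s::real. z + of_real s * b"
  have g: "(?g has_vector_derivative b) (at t)"
    by (auto intro!: derivative_eq_intros)
  have norm: "((\<lambda>s. cmod (?g s)) has_real_derivative Re (cnj u * b) / cmod u) (at t)"
  proof -
    have pos: "(Re z + t * Re b)\<^sup>2 + (Im z + t * Im b)\<^sup>2 > 0"
      using u0 unfolding u_def by (auto simp: complex_eq_iff sum_power2_gt_zero_iff)
    have "((\<lambda>s. sqrt ((Re z + s * Re b)\<^sup>2 + (Im z + s * Im b)\<^sup>2)) has_real_derivative
        Re (cnj u * b) / sqrt ((Re z + t * Re b)\<^sup>2 + (Im z + t * Im b)\<^sup>2)) (at t)"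
    proof -
      have "((\<lambda>s. (Re z + s * Re b)\<^sup>2 + (Im z + s * Im b)\<^sup>2) has_real_derivative 2 * Re (cnj u * b)) (at t)"
        by (auto intro!: derivative_eq_intros simp: u_def algebra_simps)
      note sqrt_deriv = DERIV_chain2[OF DERIV_real_sqrt[OF pos] this]
      have half: "inverse y / 2 * (2 * x) = x / y" for x y :: real
        by (simp add: field_simps)
      show ?thesis by (rule DERIV_cong[OF sqrt_deriv half])
    qed
    then show ?thesis by (simp add: cmod_def u_def)
  qed
  have r0: "cmod u > 0" using u0 by simp
  have pw: "((\<lambda>s. of_real (cmod (?g s) powr c) :: complex) has_vector_derivative
      of_real (c * cmod u powr (c - 1) * (Re (cnj u * b) / cmod u))) (at t)"
    using DERIV_fun_powr[OF norm, of c] r0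
    by (intro has_vector_derivative_of_real) (simp add: u_def has_real_derivative_iff_has_vector_derivative)
  have pi: "((\<lambda>s. ?g s powi \<beta>) has_vector_derivative b * (of_int \<beta> * u powi (\<beta> - 1))) (at t)"
  proof -
    have "((\<lambda>w. w powi \<beta>) has_field_derivative (of_int \<beta> * u powi (\<beta> - 1))) (at (?g t))"
      using u0 by (auto intro!: derivative_eq_intros simp: u_def)
    from field_vector_diff_chain_at[OF g this] show ?thesis by (simp add: o_def)
  qed
  define X where "X = u powi (\<beta> - 1)"
  define R where "R = complex_of_real (cmod u powr (c - 2))"
  have X: "u powi \<beta> = X * u" "u powi (\<beta> + 1) = X * u * u"
    using u0 power_int_add_1[of u "\<beta> - 1"] power_int_add_1[of u \<beta>] by (simp_all add: X_def)
  have uu: "complex_of_real (cmod u) * complex_of_real (cmod u) = u * cnj u"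
    using complex_norm_square[of u] by (simp add: power2_eq_square)
  have Rc: "complex_of_real (cmod u powr c) = R * (u * cnj u)"
  proof -
    have "cmod u powr c = cmod u powr (c - 2) * (cmod u * cmod u)"
      using r0 by (simp add: powr_diff power2_eq_square)
    then show ?thesis unfolding R_def uu[symmetric] by simp
  qed
  have R1: "complex_of_real (cmod u powr (c - 1) / cmod u) = R"
    using r0 unfolding R_def by (simp add: powr_diff power2_eq_square)
  have "Psi \<alpha> \<beta> w = of_real (cmod w powr c) * w powi \<beta>" if "w \<noteq> 0" for w
    using Psi_eq_power_int[OF that] by (simp add: c_def)
  then have P: "Psi (\<alpha> - 1) (\<beta> - 1) u = R * (u * cnj u) * X" "Psi (\<alpha> - 1) (\<beta> + 1) u = R * X * u * u"
    using Psi_eq_power_int[OF u0, of "\<alpha> - 1" "\<beta> - 1"] Psi_eq_power_int[OF u0, of "\<alpha> - 1" "\<beta> + 1"]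
    by (simp_all add: X flip: Rc) (simp_all add: X_def R_def c_def algebra_simps)
  have Re: "of_real (Re (cnj u * b)) = (cnj u * b + u * cnj b) / 2"
    by (simp add: complex_eq_iff)
  have "((\<lambda>s. of_real (cmod (?g s) powr c) * ?g s powi \<beta>) has_vector_derivative
      of_real (cmod u powr c) * (b * (of_int \<beta> * X))
      + of_real (c * cmod u powr (c - 1) * (Re (cnj u * b) / cmod u)) * u powi \<beta>) (at t)"
    using has_vector_derivative_mult[OF pw pi] by (simp add: u_def X_def)
  moreover have "complex_of_real (c * cmod u powr (c - 1) * (Re (cnj u * b) / cmod u))
      = of_real c * R * ((cnj u * b + u * cnj b) / 2)"
    unfolding Re[symmetric] R1[symmetric] by simp
  ultimately have "((\<lambda>s. of_real (cmod (?g s) powr c) * ?g s powi \<beta>) has_vector_derivative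
      R * (u * cnj u) * (b * (of_int \<beta> * X))
      + of_real c * R * ((cnj u * b + u * cnj b) / 2) * (X * u)) (at t)"
    by (simp only: Rc X)
  also have "R * (u * cnj u) * (b * (of_int \<beta> * X))
      + of_real c * R * ((cnj u * b + u * cnj b) / 2) * (X * u)
      = of_real ((\<alpha> + \<beta>) / 2) * (Psi (\<alpha> - 1) (\<beta> - 1) u * b)
         + of_real ((\<alpha> - \<beta>) / 2) * (Psi (\<alpha> - 1) (\<beta> + 1) u * cnj b)"
    unfolding P c_def by (simp add: field_simps)
  finally show ?thesis
  proof (rule has_vector_derivative_transform_within_open)
    show "open {s. ?g s \<noteq> 0}"
      by (intro open_Collect_neq continuous_intros)
  qed (use u0 in \<open>auto simp: Psi_eq_power_int u_def c_def\<close>)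
qed

text \<open>For \<open>\<alpha> > 1\<close> the formula persists where the segment meets zero: there \<open>Psi\<close> is of order
  \<open>\<bar>h\<bar>\<^sup>\<alpha>\<close>, so both sides are zero.\<close>

lemma has_vector_derivative_Psi:
  fixes z b :: complex and t \<alpha> :: real and \<beta> :: int
  assumes \<alpha>: "\<alpha> > 1"
  shows "((\<lambda>s. Psi \<alpha> \<beta> (z + of_real s * b)) has_vector_derivative
           of_real ((\<alpha> + \<beta>) / 2) * (Psi (\<alpha> - 1) (\<beta> - 1) (z + of_real t * b) * b)
         + of_real ((\<alpha> - \<beta>) / 2) * (Psi (\<alpha> - 1) (\<beta> + 1) (z + of_real t * b) * cnj b)) (at t)"
proof (cases "z + of_real t * b = 0")
  case True
  have shift: "z + of_real (t + h) * b = of_real h * b" for h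
    using True by (simp add: algebra_simps)
  have lim: "((\<lambda>h. \<bar>h\<bar> powr (\<alpha> - 1) * cmod b powr \<alpha>) \<longlongrightarrow> 0) (at (0::real))"
    using \<alpha> by (auto intro!: tendsto_eq_intros tendsto_zero_powrI)
  have "((\<lambda>s. Psi \<alpha> \<beta> (z + of_real s * b)) has_derivative (\<lambda>h. h *\<^sub>R 0)) (at t)"
    unfolding has_derivative_at
  proof (intro conjI)
    show "(\<lambda>h. norm (Psi \<alpha> \<beta> (z + of_real (t + h) * b) - Psi \<alpha> \<beta> (z + of_real t * b) - h *\<^sub>R 0) / norm h)
        \<midarrow>0\<rightarrow> 0"
    proof (rule Lim_transform_eventually[OF lim])
      show "\<forall>\<^sub>F h in at 0. \<bar>h\<bar> powr (\<alpha> - 1) * cmod b powr \<alpha> =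
          norm (Psi \<alpha> \<beta> (z + of_real (t + h) * b) - Psi \<alpha> \<beta> (z + of_real t * b) - h *\<^sub>R 0) / norm h"
        unfolding eventually_at_filter
        by (intro always_eventually) (simp only: shift True, simp add: norm_Psi norm_mult powr_mult powr_diff)
    qed
  qed simp
  then show ?thesis unfolding True by (simp add: has_vector_derivative_def)
next
  case False
  then show ?thesis by (rule has_vector_derivative_Psi_nonzero)
qed

text \<open>The induction step on the size. The condition \<open>\<bar>\<beta>\<bar> \<le> \<alpha>\<close> makes both coefficients of the
  derivative nonnegative, so the form is nondecreasing along the segment from the rank one part
  to \<open>A\<close>.\<close>

lemma preserves_PSD_Suc:
  fixes \<alpha> :: real and \<beta> :: int
  assumes \<alpha>: "\<alpha> > 1" "\<bar>of_int \<beta>\<bar> \<le> \<alpha>"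
    and minus: "preserves_PSD n (Psi (\<alpha> - 1) (\<beta> - 1))"
    and plus: "preserves_PSD n (Psi (\<alpha> - 1) (\<beta> + 1))"
  shows "preserves_PSD (Suc n) (Psi \<alpha> \<beta>)"
  unfolding preserves_PSD_iff
proof (intro allI impI)
  fix A assume A: "psd (Suc n) A"
  from psd_split_rank_one[OF A] obtain \<zeta> B where B: "psd n B"
    and dec: "\<And>i j. i \<le> n \<Longrightarrow> j \<le> n \<Longrightarrow> A i j = \<zeta> i * cnj (\<zeta> j) + (if i < n \<and> j < n then B i j else 0)"
    by metis
  define B0 where "B0 i j = (if i < n \<and> j < n then B i j else 0)" for i j
  define M where "M t i j = \<zeta> i * cnj (\<zeta> j) + of_real t * B0 i j" for t :: real and i j
  define p q where "p = (\<alpha> + \<beta>) / 2" and "q = (\<alpha> - \<beta>) / 2"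
  have pq: "p \<ge> 0" "q \<ge> 0" using \<alpha>(2) by (auto simp: p_def q_def)
  define D where "D t i j = of_real p * (Psi (\<alpha> - 1) (\<beta> - 1) (M t i j) * B0 i j)
         + of_real q * (Psi (\<alpha> - 1) (\<beta> + 1) (M t i j) * cnj (B0 i j))" for t i j
  have psdD: "psd n (D t)" if t: "t \<ge> 0" for t
  proof -
    have "psd n (\<lambda>i j. \<zeta> i * cnj (\<zeta> j) + of_real t * B i j)"
      by (intro psd_add psd_scale psd_rank_one B t)
    then have M: "psd n (M t)"
      by (rule psd_cong[rotated]) (simp add: M_def B0_def)
    have B0: "psd n B0"
      by (rule psd_cong[OF _ B]) (simp add: B0_def)
    have "psd n (\<lambda>i j. Psi (\<alpha> - 1) (\<beta> - 1) (M t i j))" "psd n (\<lambda>i j. Psi (\<alpha> - 1) (\<beta> + 1) (M t i j))"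
      by (rule preserves_PSD_D[OF minus M], rule preserves_PSD_D[OF plus M])
    then show ?thesis
      unfolding D_def by (intro psd_add psd_scale psd_Schur_product psd_cnj B0 pq)
  qed
  show "psd (Suc n) (\<lambda>i j. Psi \<alpha> \<beta> (A i j))"
  proof (rule psdI)
    fix i j assume "i < Suc n" "j < Suc n"
    then show "Psi \<alpha> \<beta> (A j i) = cnj (Psi \<alpha> \<beta> (A i j))"
      by (simp add: psd_herm[OF A, of i j] Psi_cnj)
  next
    fix v :: "nat \<Rightarrow> complex"
    define Q where "Q t = qform (Suc n) (\<lambda>i j. Psi \<alpha> \<beta> (M t i j)) v" for t
    have deriv: "((\<lambda>t. Re (Q t)) has_real_derivative Re (qform n (D t) v)) (at t)" for t
    proof -
      have "((\<lambda>s. Psi \<alpha> \<beta> (M s i j)) has_vector_derivative D t i j) (at t)" for i j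
        unfolding M_def D_def p_def q_def by (rule has_vector_derivative_Psi[OF \<alpha>(1)])
      then have "(Q has_vector_derivative qform (Suc n) (D t) v) (at t)"
        unfolding Q_def qform_def
        by (intro has_vector_derivative_sum has_vector_derivative_mult_left has_vector_derivative_mult_right)
      also have "qform (Suc n) (D t) v = qform n (D t) v"
        unfolding qform_def by (simp add: D_def B0_def)
      finally show ?thesis
        unfolding has_real_derivative_iff_has_vector_derivative
        by (rule bounded_linear.has_vector_derivative[OF bounded_linear_Re])
    qed
    have "0 \<le> Re (Q 0)"
    proof -
      have "Psi \<alpha> \<beta> (M 0 i j) = Psi \<alpha> \<beta> (\<zeta> i) * cnj (Psi \<alpha> \<beta> (\<zeta> j))" for i j
        by (simp add: M_def Psi_mult Psi_cnj)
      then show ?thesis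
        unfolding Q_def by (simp add: psd_nonneg[OF psd_rank_one])
    qed
    also have "Re (Q 0) \<le> Re (Q 1)"
    proof (rule DERIV_nonneg_imp_nondecreasing[where f = "\<lambda>t. Re (Q t)"])
      fix t :: real assume "0 \<le> t"
      then show "\<exists>y. ((\<lambda>t. Re (Q t)) has_real_derivative y) (at t) \<and> 0 \<le> y"
        by (intro exI[of _ "Re (qform n (D t) v)"] conjI deriv psd_nonneg psdD)
    qed simp
    also have "Q 1 = qform (Suc n) (\<lambda>i j. Psi \<alpha> \<beta> (A i j)) v"
      unfolding Q_def by (intro qform_cong) (simp_all add: M_def B0_def dec)
    finally show "0 \<le> Re (qform (Suc n) (\<lambda>i j. Psi \<alpha> \<beta> (A i j)) v)" .
  qed
qed

text \<open>In size two the splitting leaves only one entry in \<open>B\<close>, and monotonicity of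
  \<open>x powr \<alpha>\<close> replaces the derivative argument, whatever \<open>\<beta>\<close> is.\<close>

lemma preserves_PSD_2:
  assumes "\<alpha> > 0" shows "preserves_PSD 2 (Psi \<alpha> \<beta>)"
  unfolding preserves_PSD_iff
proof (intro allI impI)
  fix A assume "psd 2 A"
  then have A: "psd (Suc (Suc 0)) A" by (simp add: numeral_2_eq_2)
  from psd_split_rank_one[OF A] obtain \<zeta> B where B: "psd (Suc 0) B"
    and dec: "\<And>i j. i \<le> Suc 0 \<Longrightarrow> j \<le> Suc 0 \<Longrightarrow>
      A i j = \<zeta> i * cnj (\<zeta> j) + (if i < Suc 0 \<and> j < Suc 0 then B i j else 0)"
    by metis
  define b where "b = Re (B 0 0)"
  have b: "B 0 0 = of_real b" "b \<ge> 0"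
    using psd_diag[OF B, of 0] by (auto simp: b_def)
  define r where "r = (cmod (\<zeta> 0))\<^sup>2"
  define d where "d = (r + b) powr \<alpha> - r powr \<alpha>"
  have r: "r \<ge> 0" by (simp add: r_def)
  have d: "d \<ge> 0"
    using assms b(2) r unfolding d_def by (simp add: powr_mono2)
  have Psi_real: "Psi \<alpha> \<beta> (of_real x) = of_real (x powr \<alpha>)" if "x \<ge> 0" for x
    using that Psi_rcis[of x 0 \<alpha> \<beta>] by (cases "x = 0") auto
  have A00: "A 0 0 = of_real (r + b)"
    using dec[of 0 0] b by (simp add: r_def complex_norm_square[unfolded of_real_power])
  have P00: "Psi \<alpha> \<beta> (A 0 0) = Psi \<alpha> \<beta> (\<zeta> 0) * cnj (Psi \<alpha> \<beta> (\<zeta> 0)) + of_real d"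
  proof -
    have "Psi \<alpha> \<beta> (\<zeta> 0) * cnj (Psi \<alpha> \<beta> (\<zeta> 0)) = Psi \<alpha> \<beta> (of_real r)"
      by (simp add: r_def complex_norm_square[unfolded of_real_power] Psi_mult Psi_cnj)
    then show ?thesis using r b(2) by (simp add: A00 Psi_real d_def flip: of_real_add)
  qed
  have D: "psd (Suc (Suc 0)) (\<lambda>i j. if i = 0 \<and> j = 0 then of_real d else 0)"
  proof (rule psdI)
    fix v
    have "qform (Suc (Suc 0)) (\<lambda>i j. if i = 0 \<and> j = 0 then of_real d else 0) v = of_real (d * (cmod (v 0))\<^sup>2)"
      by (simp add: qform_def complex_norm_square[unfolded of_real_power] mult_ac)
    then show "0 \<le> Re (qform (Suc (Suc 0)) (\<lambda>i j. if i = 0 \<and> j = 0 then of_real d else 0) v)"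
      using d by simp
  qed auto
  have "psd (Suc (Suc 0)) (\<lambda>i j. Psi \<alpha> \<beta> (\<zeta> i) * cnj (Psi \<alpha> \<beta> (\<zeta> j))
      + (if i = 0 \<and> j = 0 then of_real d else 0))"
    by (intro psd_add psd_rank_one D)
  then have "psd (Suc (Suc 0)) (\<lambda>i j. Psi \<alpha> \<beta> (A i j))"
  proof (rule psd_cong[rotated])
    fix i j :: nat assume "i < Suc (Suc 0)" "j < Suc (Suc 0)"
    then show "Psi \<alpha> \<beta> (\<zeta> i) * cnj (Psi \<alpha> \<beta> (\<zeta> j)) + (if i = 0 \<and> j = 0 then of_real d else 0)
        = Psi \<alpha> \<beta> (A i j)"
      using P00 dec[of i j] by (cases "i = 0 \<and> j = 0") (auto simp: Psi_mult Psi_cnj)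
  qed
  then show "psd 2 (\<lambda>i j. Psi \<alpha> \<beta> (A i j))" by (simp add: numeral_2_eq_2)
qed

text \<open>One induction step lowers \<open>\<alpha>\<close> by one and can raise \<open>\<bar>\<beta>\<bar>\<close> by one, so the admissible
  excess of \<open>\<alpha>\<close> over \<open>\<bar>\<beta>\<bar>\<close> grows by two with the size. The strict inequality \<open>\<alpha> > 1\<close>, needed for
  differentiability at zero, is removed later by a limit.\<close>

lemma preserves_PSD_above:
  assumes "n \<ge> 3" "\<alpha> > 1" "\<alpha> > \<bar>real_of_int \<beta>\<bar> + 2 * real n - 6"
  shows "preserves_PSD n (Psi \<alpha> \<beta>)"
  using assms
proof (induction n arbitrary: \<alpha> \<beta> rule: nat_induct_at_least)
  case base
  have "preserves_PSD 2 (Psi (\<alpha> - 1) \<gamma>)" for \<gamma>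
    using base by (intro preserves_PSD_2) simp
  then have "preserves_PSD (Suc 2) (Psi \<alpha> \<beta>)"
    using base by (intro preserves_PSD_Suc) auto
  then show ?case by (simp add: numeral_3_eq_3 numeral_2_eq_2)
next
  case (Suc n)
  show ?case
    using Suc.prems Suc.hyps by (intro preserves_PSD_Suc Suc.IH) auto
qed

text \<open>Closedness in \<open>\<alpha>\<close>: for fixed \<open>\<beta>\<close> and a fixed matrix the image depends continuously on \<open>\<alpha>\<close>.\<close>

lemma preserves_PSD_limit:
  assumes "\<And>\<alpha>. \<alpha> > a \<Longrightarrow> preserves_PSD n (Psi \<alpha> \<beta>)"
  shows "preserves_PSD n (Psi a \<beta>)"
  unfolding preserves_PSD_iff
proof (intro allI impI)
  fix A assume A: "psd n A"
  have P: "psd n (\<lambda>i j. Psi \<alpha> \<beta> (A i j))" if "\<alpha> > a" for \<alpha>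
    by (rule preserves_PSD_D[OF assms[OF that] A])
  show "psd n (\<lambda>i j. Psi a \<beta> (A i j))"
  proof (rule psdI)
    fix i j assume "i < n" "j < n"
    then show "Psi a \<beta> (A j i) = cnj (Psi a \<beta> (A i j))"
      by (simp add: psd_herm[OF A, of i j] Psi_cnj)
  next
    fix v
    have "((\<lambda>\<alpha>. Psi \<alpha> \<beta> z) \<longlongrightarrow> Psi a \<beta> z) (at_right a)" for z
    proof (cases "z = 0")
      case False
      then show ?thesis
        by (auto simp: Psi_eq_power_int intro!: tendsto_intros)
    qed simp
    then have "((\<lambda>\<alpha>. Re (qform n (\<lambda>i j. Psi \<alpha> \<beta> (A i j)) v)) \<longlongrightarrow> Re (qform n (\<lambda>i j. Psi a \<beta> (A i j)) v)) (at_right a)"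
      unfolding qform_def by (intro tendsto_intros)
    then show "0 \<le> Re (qform n (\<lambda>i j. Psi a \<beta> (A i j)) v)"
    proof (rule tendsto_lowerbound)
      show "\<forall>\<^sub>F \<alpha> in at_right a. 0 \<le> Re (qform n (\<lambda>i j. Psi \<alpha> \<beta> (A i j)) v)"
        using psd_nonneg[OF P] by (auto simp: eventually_at_right_field intro: exI[of _ "a + 1"])
    qed simp
  qed
qed

section \<open>Exponents that fail\<close>

lemma Psi_eq_powr:
  assumes "z \<noteq> 0" "p + q = \<alpha>" "p - q = of_int \<beta>"
  shows "Psi \<alpha> \<beta> z = z powr of_real p * cnj (z powr of_real q)"
proof -
  define L \<theta> where "L = ln (cmod z)" and "\<theta> = Arg z"
  have Ln: "Ln z = of_real L + \<i> * of_real \<theta>"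
    using assms(1) by (simp add: L_def \<theta>_def Arg_eq_Im_Ln complex_eq_iff)
  have "z powr of_real p * cnj (z powr of_real q)
      = exp (of_real p * (of_real L + \<i> * of_real \<theta>)) * exp (of_real q * (of_real L - \<i> * of_real \<theta>))"
    using assms(1) by (simp add: powr_def Ln exp_cnj)
  also have "\<dots> = exp (of_real ((p + q) * L) + \<i> * of_real ((p - q) * \<theta>))"
    unfolding exp_add[symmetric] by (rule arg_cong[of _ _ exp]) (simp add: algebra_simps)
  also have "\<dots> = of_real (exp (\<alpha> * L)) * cis (of_int \<beta> * \<theta>)"
    by (simp only: assms(2,3) exp_add cis_conv_exp exp_of_real)
  also have "exp (\<alpha> * L) = cmod z powr \<alpha>"
    using assms(1) by (simp add: powr_def L_def)
  finally show ?thesis using assms(1) by (simp add: Psi_def rcis_def \<theta>_def)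
qed

lemma of_real_gbinomial: "(of_real (x gchoose k) :: complex) = of_real x gchoose k"
  by (simp add: gbinomial_prod_rev)

lemma summable_norm_binomial_series:
  assumes "norm (z :: complex) < 1"
  shows "summable (\<lambda>k. norm ((c gchoose k) * z ^ k))"
  using assms by (intro abs_summable_in_conv_radius) (auto simp: conv_radius_gchoose one_ereal_def)

lemma Psi_one_plus_sums:
  assumes u: "norm u < 1" and pq: "p + q = \<alpha>" "p - q = of_int \<beta>"
  shows "(\<lambda>k. \<Sum>a\<le>k. of_real ((p gchoose a) * (q gchoose (k - a))) * (u ^ a * cnj u ^ (k - a)))
           sums Psi \<alpha> \<beta> (1 + u)"
proof -
  have ne: "1 + u \<noteq> 0" using u by (metis add.inverse_inverse add_eq_0_iff norm_minus_cancel norm_one less_irrefl)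
  have u': "norm (cnj u) < 1" using u by simp
  have "cnj ((1 + u) powr of_real q) = (\<Sum>k. (of_real q gchoose k) * cnj u ^ k)"
  proof -
    have "(\<lambda>k. cnj ((of_real q gchoose k) * u ^ k)) sums cnj ((1 + u) powr of_real q)"
      using gen_binomial_complex[OF u, of "of_real q"] unfolding sums_cnj .
    then show ?thesis by (simp add: sums_iff flip: of_real_gbinomial)
  qed
  moreover have "(1 + u) powr of_real p = (\<Sum>k. (of_real p gchoose k) * u ^ k)"
    using gen_binomial_complex[OF u] by (simp add: sums_iff)
  ultimately have "(\<lambda>k. \<Sum>a\<le>k. ((of_real p gchoose a) * u ^ a) * ((of_real q gchoose (k - a)) * cnj u ^ (k - a)))
      sums Psi \<alpha> \<beta> (1 + u)"
    using Cauchy_product_sums[OF summable_norm_binomial_series[OF u] summable_norm_binomial_series[OF u']]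
    by (simp add: Psi_eq_powr[OF ne pq])
  then show ?thesis by (simp add: of_real_gbinomial mult_ac)
qed

text \<open>The test for failure. For small \<open>\<epsilon> \<ge> 0\<close> the matrix \<open>1 + \<epsilon> z\<^sub>i cnj z\<^sub>j\<close> is positive
  semidefinite, and the form of its image at \<open>cnj v\<close> is a power series in \<open>\<epsilon>\<close> whose coefficients
  are the weighted sums of squared moments \<open>\<mu>\<close>. The first \<open>M\<close> of them vanish, so dividing by
  \<open>\<epsilon>\<^sup>M\<close> and letting \<open>\<epsilon>\<close> tend to zero shows that the next one is nonnegative.\<close>

lemma leading_coefficient_nonneg:
  fixes z v :: "nat \<Rightarrow> complex" and p q :: real and n :: nat
  defines "\<mu> \<equiv> \<lambda>a b. \<Sum>i<n. v i * z i ^ a * cnj (z i) ^ b"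
  assumes pres: "preserves_PSD n (Psi \<alpha> \<beta>)"
    and pq: "p + q = \<alpha>" "p - q = of_int \<beta>"
    and vanish: "\<And>a b. a + b < M \<Longrightarrow> \<mu> a b = 0"
  shows "0 \<le> (\<Sum>a\<le>M. (p gchoose a) * (q gchoose (M - a)) * (cmod (\<mu> a (M - a)))\<^sup>2)"
proof -
  define g where "g k = (\<Sum>a\<le>k. (p gchoose a) * (q gchoose (k - a)) * (cmod (\<mu> a (k - a)))\<^sup>2)" for k
  define A where "A \<epsilon> i j = 1 + of_real \<epsilon> * (z i * cnj (z j))" for \<epsilon> :: real and i j
  define Q where "Q \<epsilon> = Re (qform n (\<lambda>i j. Psi \<alpha> \<beta> (A \<epsilon> i j)) (\<lambda>i. cnj (v i)))" for \<epsilon>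
  \<comment> \<open>A common bound for all \<open>z\<^sub>i cnj z\<^sub>j\<close>; the binomial series converge for \<open>\<bar>\<epsilon>\<bar> < 1 / b\<close>.\<close>
  define b where "b = 1 + (\<Sum>i<n. \<Sum>j<n. cmod (z i * cnj (z j)))"
  have b: "b > 0" unfolding b_def by (intro add_pos_nonneg sum_nonneg) auto
  have b_bound: "cmod (z i * cnj (z j)) \<le> b" if "i < n" "j < n" for i j
  proof -
    have "cmod (z i * cnj (z j)) \<le> (\<Sum>j<n. cmod (z i * cnj (z j)))"
      using that by (intro member_le_sum) auto
    also have "\<dots> \<le> (\<Sum>i<n. \<Sum>j<n. cmod (z i * cnj (z j)))"
      using that by (intro member_le_sum[of i "{..<n}" "\<lambda>i. \<Sum>j<n. cmod (z i * cnj (z j))"] sum_nonneg) auto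
    finally show ?thesis by (simp add: b_def)
  qed
  have moment: "(\<Sum>i<n. \<Sum>j<n. v i * (z i * cnj (z j)) ^ a * cnj (z i * cnj (z j)) ^ c * cnj (v j))
      = of_real ((cmod (\<mu> a c))\<^sup>2)" for a c
  proof -
    have "of_real ((cmod (\<mu> a c))\<^sup>2) = \<mu> a c * cnj (\<mu> a c)" by (rule complex_norm_square)
    also have "\<dots> = (\<Sum>i<n. \<Sum>j<n. v i * (z i * cnj (z j)) ^ a * cnj (z i * cnj (z j)) ^ c * cnj (v j))"
      unfolding \<mu>_def cnj_sum sum_product by (simp add: power_mult_distrib mult_ac)
    finally show ?thesis by simp
  qed
  have sums: "(\<lambda>k. g k * \<epsilon> ^ k) sums Q \<epsilon>" if "\<bar>\<epsilon>\<bar> < 1 / b" for \<epsilon> :: real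
  proof -
    define w where "w i j = z i * cnj (z j)" for i j
    define s where "s k i j = (\<Sum>a\<le>k. of_real ((p gchoose a) * (q gchoose (k - a))) * (w i j ^ a * cnj (w i j) ^ (k - a)))" for k i j
    have "(\<lambda>k. \<Sum>i<n. \<Sum>j<n. v i * (of_real (\<epsilon> ^ k) * s k i j) * cnj (v j))
        sums qform n (\<lambda>i j. Psi \<alpha> \<beta> (A \<epsilon> i j)) (\<lambda>i. cnj (v i))"
      unfolding qform_def complex_cnj_cnj
    proof (intro sums_sum sums_mult sums_mult2)
      fix i j assume ij: "i \<in> {..<n}" "j \<in> {..<n}"
      have "\<bar>\<epsilon>\<bar> * cmod (z i * cnj (z j)) \<le> \<bar>\<epsilon>\<bar> * b"
        using b_bound[of i j] ij by (intro mult_left_mono) auto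
      also have "\<dots> < 1" using that b by (simp add: field_simps)
      finally have "norm (of_real \<epsilon> * w i j) < 1" by (simp add: norm_mult w_def)
      from Psi_one_plus_sums[OF this pq]
      have "(\<lambda>k. \<Sum>a\<le>k. of_real ((p gchoose a) * (q gchoose (k - a))) *
          ((of_real \<epsilon> * w i j) ^ a * cnj (of_real \<epsilon> * w i j) ^ (k - a))) sums Psi \<alpha> \<beta> (A \<epsilon> i j)"
        by (simp add: A_def w_def)
      moreover have "(\<Sum>a\<le>k. of_real ((p gchoose a) * (q gchoose (k - a))) *
          ((of_real \<epsilon> * w i j) ^ a * cnj (of_real \<epsilon> * w i j) ^ (k - a))) = of_real (\<epsilon> ^ k) * s k i j" for k
      proof -
        have "(of_real \<epsilon> * w i j) ^ a * cnj (of_real \<epsilon> * w i j) ^ (k - a)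
            = of_real (\<epsilon> ^ k) * (w i j ^ a * cnj (w i j) ^ (k - a))" if "a \<le> k" for a
        proof -
          have "\<epsilon> ^ k = \<epsilon> ^ a * \<epsilon> ^ (k - a)" using that by (simp flip: power_add)
          then show ?thesis by (simp add: power_mult_distrib mult_ac)
        qed
        then show ?thesis unfolding s_def sum_distrib_left
          by (intro sum.cong refl) simp
      qed
      ultimately show "(\<lambda>k. of_real (\<epsilon> ^ k) * s k i j) sums Psi \<alpha> \<beta> (A \<epsilon> i j)" by simp
    qed
    moreover have "(\<Sum>i<n. \<Sum>j<n. v i * (of_real (\<epsilon> ^ k) * s k i j) * cnj (v j)) = of_real (g k * \<epsilon> ^ k)" for k
    proof -
      have "(\<Sum>i<n. \<Sum>j<n. v i * (of_real (\<epsilon> ^ k) * s k i j) * cnj (v j))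
          = (\<Sum>i<n. \<Sum>j<n. \<Sum>a\<le>k. of_real (\<epsilon> ^ k * ((p gchoose a) * (q gchoose (k - a)))) *
              (v i * w i j ^ a * cnj (w i j) ^ (k - a) * cnj (v j)))"
        unfolding s_def sum_distrib_left sum_distrib_right by (intro sum.cong refl) (simp add: mult_ac)
      also have "\<dots> = (\<Sum>a\<le>k. of_real (\<epsilon> ^ k * ((p gchoose a) * (q gchoose (k - a)))) *
              (\<Sum>i<n. \<Sum>j<n. v i * w i j ^ a * cnj (w i j) ^ (k - a) * cnj (v j)))"
        unfolding sum_distrib_left
        by (simp only: sum.swap[of _ "{..k}" "{..<n}"])
      also have "\<dots> = (\<Sum>a\<le>k. of_real (\<epsilon> ^ k * ((p gchoose a) * (q gchoose (k - a))) * (cmod (\<mu> a (k - a)))\<^sup>2))"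
        unfolding w_def moment by simp
      also have "\<dots> = of_real (g k * \<epsilon> ^ k)"
        unfolding g_def sum_distrib_right of_real_sum by (intro sum.cong refl) (simp add: mult_ac)
      finally show ?thesis .
    qed
    ultimately have "(\<lambda>k. of_real (g k * \<epsilon> ^ k)) sums qform n (\<lambda>i j. Psi \<alpha> \<beta> (A \<epsilon> i j)) (\<lambda>i. cnj (v i))"
      by simp
    from sums_Re[OF this] show ?thesis by (simp add: Q_def)
  qed
  have nonneg: "0 \<le> Q \<epsilon>" if "\<epsilon> \<ge> 0" for \<epsilon>
  proof -
    have "psd n (\<lambda>i j. 1 * cnj 1 + of_real \<epsilon> * (z i * cnj (z j)))"
      by (intro psd_add psd_scale psd_rank_one that)
    then have "psd n (A \<epsilon>)" by (simp add: A_def[abs_def])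
    then show ?thesis
      unfolding Q_def by (intro psd_nonneg preserves_PSD_D[OF pres])
  qed
  have g0: "g k = 0" if "k < M" for k
    using vanish that by (simp add: g_def)
  have "((\<lambda>\<epsilon>. Q \<epsilon> / \<epsilon> ^ M) \<longlongrightarrow> g (0 + M)) (at 0)"
  proof (rule powser_limit_0_strong)
    show "0 < 1 / b" using b by simp
    fix \<epsilon> :: real assume e: "\<epsilon> \<noteq> 0" "norm \<epsilon> < 1 / b"
    have "(\<lambda>k. g (k + M) * \<epsilon> ^ (k + M)) sums (Q \<epsilon> - (\<Sum>k<M. g k * \<epsilon> ^ k))"
      by (intro sums_split_initial_segment sums) (use e in simp)
    then have "(\<lambda>k. g (k + M) * \<epsilon> ^ (k + M) / \<epsilon> ^ M) sums (Q \<epsilon> / \<epsilon> ^ M)"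
      by (intro sums_divide) (simp add: g0)
    then show "(\<lambda>k. g (k + M) * \<epsilon> ^ k) sums (Q \<epsilon> / \<epsilon> ^ M)"
      using e(1) by (simp add: power_add)
  qed
  then have "((\<lambda>\<epsilon>. Q \<epsilon> / \<epsilon> ^ M) \<longlongrightarrow> g M) (at_right 0)"
    by (simp add: filterlim_at_split)
  then have "0 \<le> g M"
  proof (rule tendsto_lowerbound)
    show "\<forall>\<^sub>F \<epsilon> in at_right 0. 0 \<le> Q \<epsilon> / \<epsilon> ^ M"
      by (rule eventually_mono[OF eventually_at_right_less]) (simp add: nonneg)
  qed simp
  then show ?thesis by (simp add: g_def)
qed

text \<open>In the numerator \<open>x (x - 1) \<dots> (x - k)\<close> only the last factor is negative.\<close>

lemma gbinomial_neg_between: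
  fixes x :: real
  assumes "real k - 1 < x" "x < real k"
  shows "(x gchoose Suc k) < 0"
proof -
  have "(\<Prod>i<k. x - real i) > 0" using assms by (intro prod_pos) auto
  then have "(\<Prod>i<k. x - real i) * (x - real k) < 0"
    using assms by (intro mult_pos_neg) auto
  then show ?thesis
    by (simp add: gbinomial_prod_rev atLeast0LessThan divide_neg_pos del: fact_Suc)
qed

text \<open>All entries of the test matrix are positive reals here, so \<open>\<beta>\<close> drops out: by Vandermonde's
  identity the sum over \<open>a\<close> collapses to \<open>\<alpha> gchoose (n - 1)\<close>.\<close>

lemma not_preserves_PSD_below_n:
  fixes \<alpha> :: real
  assumes "real n - 3 < \<alpha>" "\<alpha> < real n - 2" "n \<ge> 2"
  shows "\<not> preserves_PSD n (Psi \<alpha> \<beta>)"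
proof
  assume pres: "preserves_PSD n (Psi \<alpha> \<beta>)"
  define M where "M = n - 1"
  have n: "n = Suc M" using assms(3) by (simp add: M_def)
  \<comment> \<open>At the points \<open>2\<^sup>i\<close> the coefficients of a polynomial \<open>W\<close> have moments \<open>W(2\<^sup>k)\<close>, so
    the required vanishing just prescribes the roots of \<open>W\<close>.\<close>
  define W :: "complex poly" where "W = (\<Prod>j<M. [:- (2 ^ j), 1:])"
  have deg: "degree W = M"
    unfolding W_def by (subst degree_prod_eq_sum_degree) auto
  have W: "poly W (2 ^ k) = (\<Prod>j<M. 2 ^ k - 2 ^ j)" for k
    by (simp add: W_def poly_prod)
  have W0: "poly W (2 ^ k) = 0" if "k < M" for k
    unfolding W using that by (intro prod_zero) auto
  have WM: "poly W (2 ^ M) \<noteq> 0"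
  proof -
    have "(2::complex) ^ M \<noteq> 2 ^ j" if "j < M" for j
    proof
      assume "(2::complex) ^ M = 2 ^ j"
      from arg_cong[OF this, of cmod] show False using that by (simp add: norm_power)
    qed
    then show ?thesis unfolding W by auto
  qed
  have mom: "(\<Sum>i<n. coeff W i * (2 ^ i) ^ a * cnj (2 ^ i) ^ b) = poly W (2 ^ (a + b))" for a b
    unfolding poly_altdef deg n lessThan_Suc_atMost
    by (intro sum.cong refl) (simp add: power_add power_mult_distrib mult.assoc flip: power_mult, simp add: mult_ac)
  define p q where "p = (\<alpha> + \<beta>) / 2" and "q = (\<alpha> - \<beta>) / 2"
  have "0 \<le> (\<Sum>a\<le>M. (p gchoose a) * (q gchoose (M - a)) *
      (cmod (\<Sum>i<n. coeff W i * (2 ^ i) ^ a * cnj (2 ^ i) ^ (M - a)))\<^sup>2)"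
    by (rule leading_coefficient_nonneg[OF pres]) (simp_all only: mom W0, simp_all add: p_def q_def field_simps)
  also have "\<dots> = (\<Sum>a\<le>M. (p gchoose a) * (q gchoose (M - a))) * (cmod (poly W (2 ^ M)))\<^sup>2"
    unfolding mom sum_distrib_right by (intro sum.cong refl) simp
  also have "(\<Sum>a\<le>M. (p gchoose a) * (q gchoose (M - a))) = (\<alpha> gchoose M)"
    using gbinomial_Vandermonde[of p q M] by (simp add: p_def q_def atMost_atLeast0 field_simps)
  finally have "0 \<le> (\<alpha> gchoose M)"
    using WM by (simp add: zero_le_mult_iff)
  moreover have "(\<alpha> gchoose Suc (M - 1)) < 0"
    using assms n by (intro gbinomial_neg_between) (auto simp: of_nat_diff)
  ultimately show False using assms n by auto
qed

text \<open>On the unit circle \<open>z\<^sup>a cnj z\<^sup>b\<close> depends only on \<open>a - b\<close>, which lies between \<open>-M\<close> and \<open>M\<close>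
  for \<open>a + b \<le> M\<close>. A discrete Fourier coefficient over \<open>2 M + 1\<close> roots of unity separates these
  values and isolates \<open>a - b = -M\<close>, that is \<open>a = 0\<close> and \<open>b = M\<close>.\<close>

lemma not_preserves_PSD_below_beta:
  fixes \<alpha> :: real and \<beta> :: int
  assumes n: "2 * m + 3 \<le> n" and \<alpha>: "\<beta> + 2 * real m - 2 < \<alpha>" "\<alpha> < \<beta> + 2 * real m"
  shows "\<not> preserves_PSD n (Psi \<alpha> \<beta>)"
proof
  assume pres: "preserves_PSD n (Psi \<alpha> \<beta>)"
  define M where "M = Suc m"
  define N where "N = 2 * M + 1"
  define \<omega> where "\<omega> = cis (2 * pi / real N)"
  have N: "N \<le> n" "N > 0" using n by (auto simp: N_def M_def)
  have \<omega>N: "\<omega> ^ N = 1" unfolding \<omega>_def Complex.DeMoivre using N by simp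
  have cnj\<omega>: "cnj \<omega> * \<omega> = 1" "\<omega> \<noteq> 0" by (simp_all add: \<omega>_def cis_cnj cis_mult)
  have \<omega>_ne: "\<omega> ^ k \<noteq> 1" if "0 < k" "k < N" for k
  proof
    assume "\<omega> ^ k = 1"
    then have "cis (2 * pi * real k / real N) = cis (2 * pi * real 0 / real N)"
      unfolding \<omega>_def Complex.DeMoivre by (simp add: mult_ac)
    from inj_onD[OF bij_betw_imp_inj_on[OF Complex.bij_betw_roots_unity[OF N(2)]] this]
    have "k = 0" using that by simp
    then show False using that by simp
  qed
  define v where "v i = (if i < N then \<omega> ^ (i * M) else 0)" for i
  define \<mu> where "\<mu> a b = (\<Sum>i<n. v i * (\<omega> ^ i) ^ a * cnj (\<omega> ^ i) ^ b)" for a b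
  have \<mu>: "\<mu> a b = (\<Sum>i<N. (\<omega> ^ (M + a - b)) ^ i)" if "b \<le> M" for a b
  proof -
    have "\<mu> a b = (\<Sum>i<N. v i * (\<omega> ^ i) ^ a * cnj (\<omega> ^ i) ^ b)"
      unfolding \<mu>_def using N by (intro sum.mono_neutral_right) (auto simp: v_def)
    also have "\<dots> = (\<Sum>i<N. (\<omega> ^ (M + a - b)) ^ i)"
    proof (intro sum.cong refl)
      fix i assume "i \<in> {..<N}"
      have e: "M + a - b + b = M + a" using that by simp
      have "v i * (\<omega> ^ i) ^ a * cnj (\<omega> ^ i) ^ b = \<omega> ^ (i * (M + a)) * (cnj \<omega>) ^ (i * b)"
        using \<open>i \<in> {..<N}\<close> by (simp add: v_def power_add distrib_left power_mult)
      also have "\<dots> = \<omega> ^ (i * (M + a - b)) * (cnj \<omega> * \<omega>) ^ (i * b)"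
        by (subst e[symmetric]) (simp add: distrib_left power_add power_mult_distrib)
      also have "\<dots> = \<omega> ^ (i * (M + a - b))" by (simp only: cnj\<omega> power_one mult_1_right)
      also have "\<dots> = (\<omega> ^ (M + a - b)) ^ i" by (simp add: mult.commute flip: power_mult)
      finally show "v i * (\<omega> ^ i) ^ a * cnj (\<omega> ^ i) ^ b = (\<omega> ^ (M + a - b)) ^ i" .
    qed
    finally show ?thesis .
  qed
  have \<mu>0: "\<mu> a b = 0" if "b \<le> M" "0 < M + a - b" "M + a - b < N" for a b
    using \<omega>_ne[OF that(2,3)] \<omega>N unfolding \<mu>[OF that(1)]
    by (subst geometric_sum) (auto simp: mult.commute simp flip: power_mult, simp add: power_mult)
  have \<mu>M: "cmod (\<mu> 0 M) = real N" by (simp add: \<mu>)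
  have \<mu>_top: "\<mu> a (M - a) = 0" if "a \<le> M" "a \<noteq> 0" for a
    by (rule \<mu>0) (use that in \<open>auto simp: N_def\<close>)
  define p q where "p = (\<alpha> + \<beta>) / 2" and "q = (\<alpha> - \<beta>) / 2"
  have "0 \<le> (\<Sum>a\<le>M. (p gchoose a) * (q gchoose (M - a)) * (cmod (\<mu> a (M - a)))\<^sup>2)"
    unfolding \<mu>_def
  proof (rule leading_coefficient_nonneg[OF pres])
    show "p + q = \<alpha>" "p - q = of_int \<beta>" by (simp_all add: p_def q_def field_simps)
    fix a b assume "a + b < M"
    then show "(\<Sum>i<n. v i * (\<omega> ^ i) ^ a * cnj (\<omega> ^ i) ^ b) = 0"
      unfolding \<mu>_def[symmetric] by (intro \<mu>0) (auto simp: N_def)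
  qed
  also have "\<dots> = (\<Sum>a\<le>M. if a = 0 then (q gchoose M) * (real N)\<^sup>2 else 0)"
    by (intro sum.cong refl) (auto simp: \<mu>M \<mu>_top)
  also have "\<dots> = (q gchoose M) * (real N)\<^sup>2" by simp
  finally have "0 \<le> (q gchoose M)" using N by (simp add: zero_le_mult_iff)
  moreover have "(q gchoose M) < 0"
    unfolding M_def using \<alpha> by (intro gbinomial_neg_between) (auto simp: q_def)
  ultimately show False by simp
qed


section \<open>The threshold\<close>

text \<open>The defining inequality of \<open>m\<close> says \<open>(m + 2) (m + 3) / 2 \<le> n\<close>. The left side counts the
  monomials of degree at most \<open>m + 1\<close>; it is at least the number \<open>2 m + 3\<close> of roots of unity that
  the test for \<open>M = m + 1\<close> takes.\<close>

lemma floor_sqrt_bound: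
  assumes "n \<ge> 3"
  defines "m \<equiv> nat \<lfloor>(sqrt (8 * real n + 1) - 5) / 2\<rfloor>"
  shows "real_of_int \<lfloor>(sqrt (8 * real n + 1) - 5) / 2\<rfloor> = real m" "2 * m + 3 \<le> n"
proof -
  let ?s = "sqrt (8 * real n + 1)"
  have "5 \<le> ?s" using assms(1) by (intro real_le_rsqrt) simp
  then have "0 \<le> \<lfloor>(?s - 5) / 2\<rfloor>" by simp
  then show m: "real_of_int \<lfloor>(?s - 5) / 2\<rfloor> = real m" unfolding m_def by simp
  have "real m \<le> (?s - 5) / 2" unfolding m[symmetric] by (rule of_int_floor_le)
  then have "2 * real m + 5 \<le> ?s" by simp
  then have "(2 * real m + 5)\<^sup>2 \<le> ?s\<^sup>2" by (intro power_mono) auto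
  then have "(2 * real m + 5)\<^sup>2 \<le> 8 * real n + 1" by simp
  then have "real ((2 * m + 5)\<^sup>2) \<le> real (8 * n + 1)" by simp
  then have "(2 * m + 5)\<^sup>2 \<le> 8 * n + 1" by (simp only: of_nat_le_iff)
  then show "2 * m + 3 \<le> n" by (simp add: power2_eq_square algebra_simps)
qed

theorem corollary3p3:
  fixes n :: nat and \<beta> :: int
  assumes "n \<ge> 3"
  shows "\<exists>\<alpha>min :: real.
           (\<forall>\<alpha> \<ge> \<alpha>min. preserves_PSD n (Psi \<alpha> \<beta>)) \<and>
           (\<forall>a. (\<forall>\<alpha> \<ge> a. preserves_PSD n (Psi \<alpha> \<beta>)) \<longrightarrow> \<alpha>min \<le> a) \<and>
           (n = 3 \<longrightarrow> \<alpha>min = max 1 (real_of_int \<bar>\<beta>\<bar>)) \<and>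
           (n \<ge> 4 \<longrightarrow>
              max (real n - 2)
                  (real_of_int \<bar>\<beta>\<bar> + 2 * real_of_int \<lfloor>(sqrt (8 * real n + 1) - 5) / 2\<rfloor>) \<le> \<alpha>min \<and>
              \<alpha>min \<le> real_of_int \<bar>\<beta>\<bar> + 2 * real n - 6)"
proof -
  define P where "P \<alpha> \<longleftrightarrow> preserves_PSD n (Psi \<alpha> \<beta>)" for \<alpha>
  define m where "m = nat \<lfloor>(sqrt (8 * real n + 1) - 5) / 2\<rfloor>"
  have m: "real_of_int \<lfloor>(sqrt (8 * real n + 1) - 5) / 2\<rfloor> = real m" "2 * m + 3 \<le> n"
    using floor_sqrt_bound[OF assms] unfolding m_def by blast+
  define U where "U = max 1 (\<bar>real_of_int \<beta>\<bar> + 2 * real n - 6)"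
  have lower_n: "real n - 2 \<le> a" if "\<forall>\<alpha>\<ge>a. P \<alpha>" for a
  proof (rule ccontr)
    assume "\<not> real n - 2 \<le> a"
    then obtain \<alpha> where "max a (real n - 3) < \<alpha>" "\<alpha> < real n - 2"
      using dense[of "max a (real n - 3)" "real n - 2"] by auto
    then show False
      using not_preserves_PSD_below_n[of n \<alpha> \<beta>] assms that by (auto simp: P_def)
  qed
  have lower_\<beta>: "\<bar>\<beta>\<bar> + 2 * real m \<le> a" if "\<forall>\<alpha>\<ge>a. P \<alpha>" for a
  proof (rule ccontr)
    assume "\<not> \<bar>\<beta>\<bar> + 2 * real m \<le> a"
    then obtain \<alpha> where "max a (\<bar>\<beta>\<bar> + 2 * real m - 2) < \<alpha>" "\<alpha> < \<bar>\<beta>\<bar> + 2 * real m"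
      using dense[of "max a (\<bar>\<beta>\<bar> + 2 * real m - 2)" "\<bar>\<beta>\<bar> + 2 * real m"] by auto
    then show False
      using not_preserves_PSD_below_beta[OF m(2), of "\<bar>\<beta>\<bar>" \<alpha>] that
      by (auto simp: P_def preserves_PSD_abs)
  qed
  have limit: "P a" if "\<And>\<alpha>. \<alpha> > a \<Longrightarrow> P \<alpha>" for a
    using that unfolding P_def by (rule preserves_PSD_limit)
  have above_U: "P \<alpha>" if "\<alpha> > U" for \<alpha>
    using assms that unfolding P_def U_def by (intro preserves_PSD_above) auto
  define S where "S = {a. \<forall>\<alpha>\<ge>a. P \<alpha>}"
  have U: "U \<in> S"
    using above_U limit[of U] unfolding S_def by (auto simp: le_less)
  have bdd: "bdd_below S"
    by (rule bdd_belowI[of _ "real n - 2"]) (simp add: S_def lower_n)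
  have least: "Inf S \<le> a" if "a \<in> S" for a
    using that bdd by (rule cInf_lower)
  have above: "P \<alpha>" if "\<alpha> > Inf S" for \<alpha>
  proof -
    from that obtain a where "a \<in> S" "a < \<alpha>"
      using cInf_less_iff[of S \<alpha>] U bdd by blast
    then show ?thesis by (simp add: S_def)
  qed
  have all: "\<forall>\<alpha>\<ge>Inf S. P \<alpha>"
    using above limit[OF above] by (auto simp: le_less)
  have n2: "real n - 2 \<le> Inf S" and b: "\<bar>\<beta>\<bar> + 2 * real m \<le> Inf S"
    by (rule lower_n[OF all], rule lower_\<beta>[OF all])
  have up: "Inf S \<le> U" by (rule least[OF U])
  show ?thesis
  proof (intro exI[of _ "Inf S"] conjI impI allI)
    show "preserves_PSD n (Psi \<alpha> \<beta>)" if "Inf S \<le> \<alpha>" for \<alpha>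
      using all that by (simp add: P_def)
    show "Inf S \<le> a" if "\<forall>\<alpha>\<ge>a. preserves_PSD n (Psi \<alpha> \<beta>)" for a
      using that by (intro least) (simp add: S_def P_def)
    show "Inf S = max 1 (real_of_int \<bar>\<beta>\<bar>)" if "n = 3"
      using n2 b up that by (auto simp: U_def)
    show "max (real n - 2) (real_of_int \<bar>\<beta>\<bar> + 2 * real_of_int \<lfloor>(sqrt (8 * real n + 1) - 5) / 2\<rfloor>) \<le> Inf S"
      using n2 b m(1) by simp
    show "Inf S \<le> real_of_int \<bar>\<beta>\<bar> + 2 * real n - 6" if "4 \<le> n"
      using up that by (auto simp: U_def max_def split: if_splits)
  qed
qed

end
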